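(* Let $\Delta<0$, $\Delta\equiv 0,1\pmod 4$, be a fundamental discriminant, and let $S_\Delta$ be the set of all reduced forms of discriminant $\Delta$. If the class number $h(\Delta)$ is even, then $m=0$ is the only integer represented by all forms in $S_\Delta$.
   Context: Conventions: "form" means an integral, binary, positive definite, primitive, reduced quadratic form $Q(x,y)=ax^2+bxy+cy^2$ with $a,b,c\in\mathbb{Z}$. Primitive means $\gcd(a,b,c)=1$; reduced means $|b|\leq a\leq c$, and $b\geq 0$ if $|b|=a$ or $a=c$. The discriminant is $\Delta=b^2-4ac$. $Q$ represents an integer $m$ if $Q(x,y)=m$ for some $x,y\in\mathbb{Z}$ (so every form represents $0$). The set $S_\Delta$ of forms of discriminant $\Delta$ is finite, and $h(\Delta)=|S_\Delta|$ is the class number (the number of proper, i.e. $\mathrm{SL}_2(\mathbb{Z})$-, equivalence classes of primitive positive definite binary quadratic forms of discriminant $\Delta$). A discriminant $\Delta$ is fundamental if either $\Delta\equiv 1\pmod 4$ is square-free, or $\Delta=4n$ with $n\equiv 2,3\pmod 4$ square-free. *)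

theory Defs
  imports "HOL-Computational_Algebra.Computational_Algebra"
begin

text \<open>
  \<open>BQF a b c\<close> stands for the integral binary quadratic form \<open>a x\<^sup>2 + b x y + c y\<^sup>2\<close>.
\<close>

datatype bqf = BQF (coeff_a: int) (coeff_b: int) (coeff_c: int)

definition bqf_eval :: "bqf \<Rightarrow> int \<Rightarrow> int \<Rightarrow> int" where
  "bqf_eval Q x y = coeff_a Q * x\<^sup>2 + coeff_b Q * x * y + coeff_c Q * y\<^sup>2"

definition discriminant :: "bqf \<Rightarrow> int" where
  "discriminant Q = (coeff_b Q)\<^sup>2 - 4 * coeff_a Q * coeff_c Q"

definition positive_definite :: "bqf \<Rightarrow> bool" where
  "positive_definite Q \<longleftrightarrow> (\<forall>x y. (x, y) \<noteq> (0, 0) \<longrightarrow> bqf_eval Q x y > 0)"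

definition primitive :: "bqf \<Rightarrow> bool" where
  "primitive Q \<longleftrightarrow> Gcd {coeff_a Q, coeff_b Q, coeff_c Q} = 1"

definition reduced :: "bqf \<Rightarrow> bool" where
  "reduced Q \<longleftrightarrow>
     \<bar>coeff_b Q\<bar> \<le> coeff_a Q \<and> coeff_a Q \<le> coeff_c Q \<and>
     (\<bar>coeff_b Q\<bar> = coeff_a Q \<or> coeff_a Q = coeff_c Q \<longrightarrow> coeff_b Q \<ge> 0)"

text \<open>Zero is allowed as a value, with \<open>x = y = 0\<close>; so every form represents 0.\<close>

definition represents :: "bqf \<Rightarrow> int \<Rightarrow> bool" where
  "represents Q m \<longleftrightarrow> (\<exists>x y. bqf_eval Q x y = m)"

definition reduced_forms :: "int \<Rightarrow> bqf set" where
  "reduced_forms \<Delta> =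
     {Q. positive_definite Q \<and> primitive Q \<and> reduced Q \<and> discriminant Q = \<Delta>}"

definition class_number :: "int \<Rightarrow> nat" where
  "class_number \<Delta> = card (reduced_forms \<Delta>)"

definition fundamental_discriminant :: "int \<Rightarrow> bool" where
  "fundamental_discriminant \<Delta> \<longleftrightarrow>
     (\<Delta> mod 4 = 1 \<and> squarefree \<Delta>) \<or>
     (\<exists>n. \<Delta> = 4 * n \<and> (n mod 4 = 2 \<or> n mod 4 = 3) \<and> squarefree n)"

text \<open>
  Since \<open>card\<close> is 0 on infinite sets, finiteness is what makes \<open>class_number\<close> meaningful.
\<close>

lemma finite_reduced_forms: "finite (reduced_forms \<Delta>)"
proof (rule finite_subset)
  let ?I = "{\<Delta>..-\<Delta>}"
  show "reduced_forms \<Delta> \<subseteq> (\<lambda>(a, b, c). BQF a b c) ` (?I \<times> ?I \<times> ?I)"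
  proof
    fix Q assume Q: "Q \<in> reduced_forms \<Delta>"
    obtain a b c where abc: "Q = BQF a b c" by (cases Q)
    have "bqf_eval Q 1 0 > 0"
      using Q unfolding reduced_forms_def positive_definite_def by simp
    then have a: "a > 0" by (simp add: abc bqf_eval_def)
    have le: "\<bar>b\<bar> \<le> a" "a \<le> c" and disc: "b\<^sup>2 - 4 * (a * c) = \<Delta>"
      using Q by (simp_all add: abc reduced_forms_def reduced_def discriminant_def)
    have "b\<^sup>2 \<le> a\<^sup>2" using le(1) abs_le_square_iff[of b a] a by simp
    moreover have "a\<^sup>2 \<le> a * c" using a le(2) by (simp add: power2_eq_square)
    moreover have "c \<le> a * c" using mult_right_mono[of 1 a c] a le(2) by simp
    ultimately have "c \<le> - \<Delta>" using disc a le(2) by linarith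
    then have "(a, b, c) \<in> ?I \<times> ?I \<times> ?I" using le a by auto
    then show "Q \<in> (\<lambda>(a, b, c). BQF a b c) ` (?I \<times> ?I \<times> ?I)"
      unfolding abc by force
  qed
qed simp

end

theory Submission
  imports Defs
begin

text \<open>
  Why the theorem holds: suppose that some \<open>m \<noteq> 0\<close> is represented by all reduced forms of
  discriminant \<open>\<Delta>\<close>. The principal form is the norm form of the quadratic order, and its values act
  on the values of every form by multiplication (\<open>norm_form_multiplies\<close>). Hence every form
  represents the nonzero square \<open>m\<^sup>2\<close>. For a fundamental discriminant such a form lies in the
  principal genus, and the classes of the principal genus are the squares of the class group. So
  squaring is onto on a finite abelian group, and the group has odd order.

  The proof carries this out on forms, without constructing the class group. A form that represents
  a nonzero square is properly equivalent to some \<open>k\<^sup>2 x\<^sup>2 + b x y + c y\<^sup>2\<close> with \<open>k\<close> and \<open>b\<close>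
  coprime (\<open>square_leading_coefficient\<close>), which in the class group is the square of
  \<open>k x\<^sup>2 + b x y + k c y\<^sup>2\<close>. Choosing the reduced form of the latter gives a map \<open>root\<close> from the
  reduced forms to themselves. It is injective because squaring is well defined on proper
  equivalence classes (\<open>duplication_well_defined\<close>), and therefore bijective. If \<open>root Q\<close> is
  equivalent to its own opposite, that is, has order at most two in the class group, then \<open>Q\<close> is
  the principal form (\<open>ambiguous_duplication\<close>). So there is only one ambiguous reduced form.
  The involution \<open>b \<mapsto> - b\<close> pairs off the reduced forms that are not visibly ambiguous
  (\<open>card_reduced_forms_parity\<close>), and the class number is odd.
\<close>

section \<open>Proper equivalence\<close>

text \<open>
  This is \<open>Q(p x + q y, r x + s y)\<close>, the action of the matrix with rows \<open>(p, q)\<close> and \<open>(r, s)\<close>.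
\<close>

definition subst_form :: "bqf \<Rightarrow> int \<Rightarrow> int \<Rightarrow> int \<Rightarrow> int \<Rightarrow> bqf" where
  "subst_form Q p q r s =
     BQF (bqf_eval Q p r)
       (2 * coeff_a Q * p * q + coeff_b Q * (p * s + q * r) + 2 * coeff_c Q * r * s)
       (bqf_eval Q q s)"

definition properly_equivalent :: "bqf \<Rightarrow> bqf \<Rightarrow> bool" where
  "properly_equivalent Q R \<longleftrightarrow> (\<exists>p q r s. p * s - q * r = 1 \<and> R = subst_form Q p q r s)"

lemma subst_form_comp:
  "subst_form (subst_form Q p q r s) p' q' r' s' =
     subst_form Q (p * p' + q * r') (p * q' + q * s') (r * p' + s * r') (r * q' + s * s')"
  unfolding subst_form_def bqf_eval_def by (simp add: algebra_simps power2_eq_square)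

lemma discriminant_subst_form:
  "discriminant (subst_form Q p q r s) = (p * s - q * r)\<^sup>2 * discriminant Q"
  unfolding subst_form_def bqf_eval_def discriminant_def
  by (simp add: algebra_simps power2_eq_square)

lemma subst_form_id: "subst_form Q 1 0 0 1 = Q"
  by (cases Q) (simp add: subst_form_def bqf_eval_def)

lemma properly_equivalentI:
  "p * s - q * r = 1 \<Longrightarrow> properly_equivalent Q (subst_form Q p q r s)"
  unfolding properly_equivalent_def by blast

lemma properly_equivalent_discriminant:
  "properly_equivalent Q R \<Longrightarrow> discriminant R = discriminant Q"
  unfolding properly_equivalent_def by (auto simp: discriminant_subst_form)

lemma properly_equivalent_trans:
  assumes "properly_equivalent Q R" "properly_equivalent R T"
  shows "properly_equivalent Q T"
proof -
  obtain p q r s where M: "p * s - q * r = 1" "R = subst_form Q p q r s"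
    using assms(1) unfolding properly_equivalent_def by blast
  obtain p' q' r' s' where M': "p' * s' - q' * r' = 1" "T = subst_form R p' q' r' s'"
    using assms(2) unfolding properly_equivalent_def by blast
  have "(p * p' + q * r') * (r * q' + s * s') - (p * q' + q * s') * (r * p' + s * r')
      = (p * s - q * r) * (p' * s' - q' * r')"
    by (simp add: algebra_simps)
  then show ?thesis
    using M M' properly_equivalentI by (simp add: subst_form_comp)
qed

lemma properly_equivalent_sym:
  assumes "properly_equivalent Q R"
  shows "properly_equivalent R Q"
proof -
  obtain p q r s where M: "p * s - q * r = 1" "R = subst_form Q p q r s"
    using assms unfolding properly_equivalent_def by blast
  have "subst_form R s (- q) (- r) p = subst_form Q 1 0 0 1"
    using M by (simp add: subst_form_comp algebra_simps)
  then show ?thesis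
    using M(1) properly_equivalentI[of s p "- q" "- r" R]
    by (simp add: subst_form_id algebra_simps)
qed

lemma properly_equivalent_represents:
  assumes "properly_equivalent Q R" "represents R m"
  shows "represents Q m"
proof -
  obtain p q r s where R: "R = subst_form Q p q r s"
    using assms(1) unfolding properly_equivalent_def by blast
  have "bqf_eval R x y = bqf_eval Q (p * x + q * y) (r * x + s * y)" for x y
    unfolding R subst_form_def bqf_eval_def by (simp add: algebra_simps power2_eq_square)
  then show ?thesis using assms(2) unfolding represents_def by metis
qed

section \<open>Reduction theory\<close>

lemma form_eqI_discriminant:
  assumes "coeff_a Q = coeff_a R" "coeff_b Q = coeff_b R" "coeff_a Q \<noteq> 0"
    and "discriminant Q = discriminant R"
  shows "Q = R"
  using assms by (cases Q; cases R) (simp add: discriminant_def)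

lemma four_a_eval:
  "4 * coeff_a Q * bqf_eval Q x y =
     (2 * coeff_a Q * x + coeff_b Q * y)\<^sup>2 - discriminant Q * y\<^sup>2"
  by (simp add: bqf_eval_def discriminant_def algebra_simps power2_eq_square)

lemma eval_pos:
  assumes "coeff_a Q > 0" "discriminant Q < 0" "(x, y) \<noteq> (0, 0)"
  shows "bqf_eval Q x y > 0"
proof (cases "y = 0")
  case True
  then show ?thesis using assms by (simp add: bqf_eval_def)
next
  case False
  then have "discriminant Q * y\<^sup>2 < 0" using assms(2) by (simp add: mult_neg_pos)
  then have "4 * coeff_a Q * bqf_eval Q x y > 0"
    unfolding four_a_eval by (smt (verit) zero_le_power2)
  then show ?thesis using assms(1) by (simp add: zero_less_mult_iff)
qed

lemma positive_definite_iff: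
  assumes "discriminant Q < 0"
  shows "positive_definite Q \<longleftrightarrow> coeff_a Q > 0"
proof
  assume "positive_definite Q"
  then have "bqf_eval Q 1 0 > 0" unfolding positive_definite_def by simp
  then show "coeff_a Q > 0" by (simp add: bqf_eval_def)
next
  assume "coeff_a Q > 0"
  then show "positive_definite Q"
    using eval_pos assms unfolding positive_definite_def by blast
qed

lemma properly_equivalent_a_pos:
  assumes "coeff_a Q > 0" "discriminant Q < 0" "properly_equivalent Q R"
  shows "coeff_a R > 0"
proof -
  obtain p q r s where M: "p * s - q * r = 1" "R = subst_form Q p q r s"
    using assms(3) unfolding properly_equivalent_def by blast
  have "(p, r) \<noteq> (0, 0)" using M(1) by auto
  then show ?thesis using eval_pos[OF assms(1,2)] M(2) by (simp add: subst_form_def)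
qed

text \<open>
  A form with minimal leading coefficient in its class, translated so that \<open>- a < b \<le> a\<close>, has
  \<open>a \<le> c\<close>, because swapping the variables would otherwise decrease \<open>a\<close>. The only remaining
  obstruction is \<open>a = c\<close> with \<open>b < 0\<close>, and the swap removes it.
\<close>

lemma exists_reduced:
  assumes "coeff_a Q > 0" "discriminant Q < 0"
  shows "\<exists>R. properly_equivalent Q R \<and> reduced R"
proof -
  have "properly_equivalent Q Q"
    using properly_equivalentI[of 1 1 0 0 Q] by (simp add: subst_form_id)
  then obtain R where QR: "properly_equivalent Q R"
    and least: "\<And>T. properly_equivalent Q T \<Longrightarrow> nat (coeff_a R) \<le> nat (coeff_a T)"
    using ex_has_least_nat[of "properly_equivalent Q" Q "\<lambda>T. nat (coeff_a T)"] by blast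
  have min: "coeff_a R \<le> coeff_a T" if "properly_equivalent R T" for T
    using least[OF properly_equivalent_trans[OF QR that]]
      properly_equivalent_a_pos[OF assms properly_equivalent_trans[OF QR that]] by linarith
  define a where "a = coeff_a R"
  have a: "a > 0" unfolding a_def by (rule properly_equivalent_a_pos[OF assms QR])
  (* The shift makes b + a - 1 a remainder modulo 2 a, so that b lies in {- a + 1..a}. *)
  define t where "t = - ((coeff_b R + a - 1) div (2 * a))"
  define U where "U = subst_form R 1 t 0 1"
  have RU: "properly_equivalent R U"
    unfolding U_def by (rule properly_equivalentI) simp
  obtain b c where U: "U = BQF a b c"
    by (cases U) (simp add: U_def subst_form_def bqf_eval_def a_def)
  have "b = (coeff_b R + a - 1) mod (2 * a) - a + 1"
    using U unfolding U_def t_def subst_form_def bqf_eval_def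
    by (simp add: a_def minus_div_mult_eq_mod[symmetric] algebra_simps)
  moreover have "0 \<le> (coeff_b R + a - 1) mod (2 * a)" "(coeff_b R + a - 1) mod (2 * a) < 2 * a"
    using a by simp_all
  ultimately have b: "- a < b" "b \<le> a" by linarith+
  define W where "W = subst_form U 0 (- 1) 1 0"
  have W: "W = BQF c (- b) a" by (simp add: W_def U subst_form_def bqf_eval_def)
  have UW: "properly_equivalent U W"
    unfolding W_def by (rule properly_equivalentI) simp
  have c: "a \<le> c" using min[OF properly_equivalent_trans[OF RU UW]] by (simp add: W a_def)
  have "reduced U \<or> reduced W"
    using b c by (auto simp: U W reduced_def)
  then show ?thesis
    using QR RU UW properly_equivalent_trans by blast
qed

text \<open>
  The coefficients \<open>a\<close> and \<open>c\<close> of a reduced form are its first two successive minima. Since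
  \<open>\<bar>b\<bar> \<le> a\<close>, the form is bounded below by \<open>a (X\<^sup>2 - X Y + Y\<^sup>2) + (c - a) Y\<^sup>2\<close> with
  \<open>X = \<bar>x\<bar>\<close> and \<open>Y = \<bar>y\<bar>\<close>.
\<close>

lemma reduced_eval_ge:
  assumes red: "reduced Q" and pos: "coeff_a Q > 0"
  shows "y \<noteq> 0 \<Longrightarrow> bqf_eval Q x y \<ge> coeff_c Q"
    and "(x, y) \<noteq> (0, 0) \<Longrightarrow> bqf_eval Q x y \<ge> coeff_a Q"
proof -
  obtain a b c where Q: "Q = BQF a b c" by (cases Q)
  have a: "a > 0" "\<bar>b\<bar> \<le> a" "a \<le> c" using red pos by (auto simp: Q reduced_def)
  have c_le: "c \<le> bqf_eval Q x y" if y: "y \<noteq> 0" for x y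
  proof -
    define X Y where "X = \<bar>x\<bar>" and "Y = \<bar>y\<bar>"
    have XY: "X \<ge> 0" "Y \<ge> 1" using y by (auto simp: X_def Y_def)
    have "\<bar>b * x * y\<bar> = \<bar>b\<bar> * (X * Y)" by (simp add: X_def Y_def abs_mult)
    also have "\<dots> \<le> a * (X * Y)" using a XY by (intro mult_right_mono) auto
    finally have "bqf_eval Q x y \<ge> a * X\<^sup>2 - a * (X * Y) + c * Y\<^sup>2"
      by (simp add: bqf_eval_def Q X_def Y_def)
    moreover have "a * X\<^sup>2 - a * (X * Y) + c * Y\<^sup>2 \<ge> c"
    proof -
      have Y2: "Y\<^sup>2 \<ge> 1" using XY by simp
      have "(c - a) * (Y\<^sup>2 - 1) \<ge> 0"
        using a Y2 by (intro mult_nonneg_nonneg) linarith+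
      moreover have "a * (X\<^sup>2 - X * Y + Y\<^sup>2 - 1) \<ge> 0"
      proof -
        have "4 * (X\<^sup>2 - X * Y + Y\<^sup>2) = (2 * X - Y)\<^sup>2 + 3 * Y\<^sup>2"
          by (simp add: algebra_simps power2_eq_square)
        then have "4 * (X\<^sup>2 - X * Y + Y\<^sup>2) > 0" using Y2 by (smt (verit) zero_le_power2)
        then have "X\<^sup>2 - X * Y + Y\<^sup>2 > 0" by (simp only: zero_less_mult_iff) simp
        then show ?thesis using a by simp
      qed
      ultimately show ?thesis by (simp add: algebra_simps)
    qed
    ultimately show ?thesis by linarith
  qed
  show "y \<noteq> 0 \<Longrightarrow> bqf_eval Q x y \<ge> coeff_c Q" using c_le by (simp add: Q)
  show "bqf_eval Q x y \<ge> coeff_a Q" if "(x, y) \<noteq> (0, 0)"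
  proof (cases "y = 0")
    case True
    then have "x\<^sup>2 \<ge> 1" using that by (smt (verit) power2_less_eq_zero_iff)
    then show ?thesis using True a by (simp add: bqf_eval_def Q)
  next
    case False
    then show ?thesis using c_le[of y x] a by (simp add: Q)
  qed
qed

text \<open>
  The leading coefficient is the minimum of the form, hence an invariant of the class. If \<open>a < c\<close>,
  only the vectors \<open>(1, 0)\<close> and \<open>(-1, 0)\<close> attain it, so the forms differ by a translation, which
  is trivial because \<open>b\<close> is normalised to \<open>- a < b \<le> a\<close>. If \<open>a = c\<close> in both forms, the
  discriminant determines \<open>b \<ge> 0\<close>.
\<close>

lemma reduced_unique:
  assumes "reduced Q" "reduced R" "coeff_a Q > 0" "coeff_a R > 0" "properly_equivalent Q R"
  shows "Q = R"
proof -
  have le: "coeff_a T \<le> coeff_a U"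
    if "reduced T" "coeff_a T > 0" "properly_equivalent T U" for T U
  proof -
    obtain p q r s where M: "p * s - q * r = 1" "U = subst_form T p q r s"
      using \<open>properly_equivalent T U\<close> unfolding properly_equivalent_def by blast
    have "(p, r) \<noteq> (0, 0)" using M(1) by auto
    then show ?thesis
      using reduced_eval_ge(2)[OF that(1,2)] M(2) by (simp add: subst_form_def)
  qed
  have aa: "coeff_a Q = coeff_a R"
    using le[of Q R] le[of R Q] assms properly_equivalent_sym by fastforce
  have strict: "coeff_b T = coeff_b U"
    if T: "reduced T" "coeff_a T > 0" "coeff_a T < coeff_c T" and U: "reduced U"
      and a: "coeff_a T = coeff_a U" and TU: "properly_equivalent T U" for T U
  proof -
    obtain p q r s where M: "p * s - q * r = 1" "U = subst_form T p q r s"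
      using TU unfolding properly_equivalent_def by blast
    have "bqf_eval T p r = coeff_a T" using a M(2) by (simp add: subst_form_def)
    then have r: "r = 0" using reduced_eval_ge(1)[OF T(1,2), of r p] T(3) by fastforce
    then have "p * s = 1" using M(1) by simp
    obtain t where t: "coeff_b U = coeff_b T + 2 * coeff_a T * t"
    proof
      show "coeff_b U = coeff_b T + 2 * coeff_a T * (p * q)"
        using M(2) r \<open>p * s = 1\<close> by (simp add: subst_form_def)
    qed
    have bT: "- coeff_a T < coeff_b T" "coeff_b T \<le> coeff_a T"
      using T by (auto simp: reduced_def)
    have bU: "- coeff_a T < coeff_b U" "coeff_b U \<le> coeff_a T"
      using U a T(2) by (auto simp: reduced_def)
    have "coeff_a T * t < coeff_a T * 1" "coeff_a T * (- 1) < coeff_a T * t"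
      using bT bU t by linarith+
    then have "t < 1" "- 1 < t" using T(2) mult_less_cancel_left_pos by blast+
    then show ?thesis using t by simp
  qed
  have disc: "discriminant R = discriminant Q"
    using assms(5) by (rule properly_equivalent_discriminant)
  have "coeff_b Q = coeff_b R"
  proof (cases "coeff_a Q < coeff_c Q \<or> coeff_a R < coeff_c R")
    case True
    then show ?thesis
      using strict[of Q R] strict[of R Q] assms aa properly_equivalent_sym by fastforce
  next
    case False
    then have c: "coeff_c Q = coeff_a Q" "coeff_c R = coeff_a R"
      using assms(1,2) by (auto simp: reduced_def)
    then have "(coeff_b Q)\<^sup>2 = (coeff_b R)\<^sup>2" using disc aa by (simp add: discriminant_def)
    moreover have "coeff_b Q \<ge> 0" "coeff_b R \<ge> 0"
      using assms(1,2) c by (simp_all add: reduced_def)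
    ultimately show ?thesis by simp
  qed
  then show ?thesis using form_eqI_discriminant aa disc assms(3) by simp
qed

section \<open>Duplication and ambiguous forms\<close>

text \<open>
  Squaring in the class group sends the class of \<open>f = (k, b, k c)\<close> with \<open>k\<close>, \<open>b\<close> coprime to that
  of \<open>F = (k\<^sup>2, b, c)\<close>. Behind this is the symmetric bilinear map \<open>B\<close> on \<open>\<int>\<^sup>2\<close> with
  \<open>B(e\<^sub>1, e\<^sub>1) = (1, 0)\<close>, \<open>B(e\<^sub>1, e\<^sub>2) = (0, k)\<close>, \<open>B(e\<^sub>2, e\<^sub>2) = (- c, b)\<close>, the
  multiplication of elements of the ideal, for which \<open>F(B(v, v)) = f(v)\<^sup>2\<close>.
  When \<open>g = (l, d, l e)\<close> is \<open>f\<close> in another basis \<open>v\<^sub>1\<close>, \<open>v\<^sub>2\<close>, the basis in which \<open>F\<close> becomes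
  \<open>(l\<^sup>2, d, e)\<close> consists of \<open>B(v\<^sub>1, v\<^sub>1)\<close> and \<open>B(v\<^sub>1, v\<^sub>2) / l\<close>. The second vector is
  integral because \<open>l B(v\<^sub>2, v\<^sub>2) + l e B(v\<^sub>1, v\<^sub>1) = d B(v\<^sub>1, v\<^sub>2)\<close> and \<open>l\<close>, \<open>d\<close> are coprime.
\<close>

lemma duplication_well_defined:
  assumes equiv: "properly_equivalent (BQF k b (k * c)) (BQF l d (l * e))"
    and cop: "coprime l d" and l0: "l \<noteq> 0"
  shows "properly_equivalent (BQF (k\<^sup>2) b c) (BQF (l\<^sup>2) d e)"
proof -
  obtain p q r s where det: "p * s - q * r = 1"
    and l: "l = k * p\<^sup>2 + b * p * r + k * c * r\<^sup>2"
    and d: "d = 2 * k * p * q + b * (p * s + q * r) + 2 * (k * c) * r * s"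
    and le: "l * e = k * q\<^sup>2 + b * q * s + k * c * s\<^sup>2"
    using equiv by (auto simp: properly_equivalent_def subst_form_def bqf_eval_def)
  (* (Xij, Yij) is B(vi, vj) for v1 = (p, r) and v2 = (q, s). *)
  define X11 X12 X22 where "X11 = p\<^sup>2 - c * r\<^sup>2" and "X12 = p * q - c * r * s"
    and "X22 = q\<^sup>2 - c * s\<^sup>2"
  define Y11 Y12 Y22 where "Y11 = 2 * k * p * r + b * r\<^sup>2"
    and "Y12 = k * (p * s + q * r) + b * r * s" and "Y22 = 2 * k * q * s + b * s\<^sup>2"
  obtain u v where uv: "u * l + v * d = 1"
    using cop bezout_int[of l d] by auto
  (* Integral coordinates of B(v1, v2) / l, using 1 / l = u + v d / l. *)
  define X2 Y2 where "X2 = u * X12 + v * (X22 + e * X11)"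
    and "Y2 = u * Y12 + v * (Y22 + e * Y11)"
  have "(k * p\<^sup>2 + b * p * r + k * c * r\<^sup>2) * X22
      + (k * q\<^sup>2 + b * q * s + k * c * s\<^sup>2) * X11 = d * X12"
    unfolding d X11_def X12_def X22_def
    by (simp add: algebra_simps power2_eq_square)
  then have "l * X22 + (l * e) * X11 = d * X12"
    unfolding l[symmetric] le[symmetric] .
  moreover have "l * X2 = u * l * X12 + v * (l * X22 + (l * e) * X11)"
    by (simp add: X2_def algebra_simps)
  ultimately have "l * X2 = (u * l + v * d) * X12" by (simp add: algebra_simps)
  then have lX2: "l * X2 = X12" by (simp add: uv)
  have "(k * p\<^sup>2 + b * p * r + k * c * r\<^sup>2) * Y22
      + (k * q\<^sup>2 + b * q * s + k * c * s\<^sup>2) * Y11 = d * Y12"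
    unfolding d Y11_def Y12_def Y22_def
    by (simp add: algebra_simps power2_eq_square)
  then have "l * Y22 + (l * e) * Y11 = d * Y12"
    unfolding l[symmetric] le[symmetric] .
  moreover have "l * Y2 = u * l * Y12 + v * (l * Y22 + (l * e) * Y11)"
    by (simp add: Y2_def algebra_simps)
  ultimately have "l * Y2 = (u * l + v * d) * Y12" by (simp add: algebra_simps)
  then have lY2: "l * Y2 = Y12" by (simp add: uv)
  have "X11 * Y12 - Y11 * X12 = (p * s - q * r) * l"
    unfolding l X11_def X12_def Y11_def Y12_def
    by (simp add: algebra_simps power2_eq_square)
  then have "l * (X11 * Y2 - X2 * Y11) = l * 1"
    using det by (simp add: lX2[symmetric] lY2[symmetric] algebra_simps)
  then have det2: "X11 * Y2 - X2 * Y11 = 1" using l0 by simp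
  define F where "F = BQF (k\<^sup>2) b c"
  define G where "G = subst_form F X11 X2 Y11 Y2"
  have FG: "properly_equivalent F G"
    unfolding G_def by (rule properly_equivalentI[OF det2])
  have Ga: "coeff_a G = l\<^sup>2"
    unfolding G_def F_def subst_form_def bqf_eval_def l X11_def Y11_def
    by (simp add: algebra_simps power2_eq_square)
  have "l * coeff_b G
      = 2 * k\<^sup>2 * X11 * X12 + b * (X11 * Y12 + X12 * Y11) + 2 * c * Y11 * Y12"
    by (simp add: G_def F_def subst_form_def lX2[symmetric] lY2[symmetric] algebra_simps)
  also have "\<dots> = l * d"
    unfolding l d X11_def Y11_def X12_def Y12_def
    by (simp add: algebra_simps power2_eq_square)
  finally have Gb: "coeff_b G = d" using l0 by simp
  have "discriminant (BQF k b (k * c)) = discriminant (BQF l d (l * e))"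
    using properly_equivalent_discriminant[OF equiv] by simp
  then have "discriminant G = discriminant (BQF (l\<^sup>2) d e)"
    using properly_equivalent_discriminant[OF FG]
    by (simp add: F_def discriminant_def power2_eq_square algebra_simps)
  then have "G = BQF (l\<^sup>2) d e"
    using form_eqI_discriminant Ga Gb l0 by simp
  then show ?thesis using FG by (simp add: F_def)
qed

text \<open>
  An automorphism of determinant \<open>-1\<close> is the same as a proper equivalence with the opposite form
  \<open>(a, - b, c)\<close>, so these forms are the ones whose class has order at most two.
\<close>

definition ambiguous :: "bqf \<Rightarrow> bool" where
  "ambiguous Q \<longleftrightarrow> (\<exists>p q r s. p * s - q * r = - 1 \<and> subst_form Q p q r s = Q)"

lemma ambiguous_equivalent:
  assumes "ambiguous Q" "properly_equivalent Q R"
  shows "ambiguous R"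
proof -
  obtain p q r s where S: "p * s - q * r = - 1" "subst_form Q p q r s = Q"
    using assms(1) unfolding ambiguous_def by blast
  obtain p1 q1 r1 s1 where M: "p1 * s1 - q1 * r1 = 1" "R = subst_form Q p1 q1 r1 s1"
    using assms(2) unfolding properly_equivalent_def by blast
  obtain p2 q2 r2 s2 where N: "p2 * s2 - q2 * r2 = 1" "Q = subst_form R p2 q2 r2 s2"
    using properly_equivalent_sym[OF assms(2)] unfolding properly_equivalent_def by blast
  have eq: "subst_form (subst_form (subst_form R p2 q2 r2 s2) p q r s) p1 q1 r1 s1 = R"
    using S(2) M(2) N(2) by metis
  define p3 q3 r3 s3 where "p3 = p2 * p + q2 * r" and "q3 = p2 * q + q2 * s"
    and "r3 = r2 * p + s2 * r" and "s3 = r2 * q + s2 * s"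
  have "p3 * s3 - q3 * r3 = (p2 * s2 - q2 * r2) * (p * s - q * r)"
    unfolding p3_def q3_def r3_def s3_def by (simp add: algebra_simps)
  moreover have "(p3 * p1 + q3 * r1) * (r3 * q1 + s3 * s1)
      - (p3 * q1 + q3 * s1) * (r3 * p1 + s3 * r1)
      = (p3 * s3 - q3 * r3) * (p1 * s1 - q1 * r1)"
    by (simp add: algebra_simps)
  ultimately show ?thesis
    using eq S(1) M(1) N(1) unfolding ambiguous_def subst_form_comp p3_def q3_def r3_def s3_def
    by (metis mult_1 mult_1_right)
qed

lemma ambiguous_if_symmetric:
  assumes "coeff_b Q = 0 \<or> coeff_b Q = coeff_a Q \<or> coeff_a Q = coeff_c Q"
  shows "ambiguous Q"
proof -
  obtain a b c where Q: "Q = BQF a b c" by (cases Q)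
  consider "b = 0" | "b = a" | "a = c" using assms by (auto simp: Q)
  then show ?thesis
  proof cases
    case 1
    then have "subst_form Q 1 0 0 (- 1) = Q" by (simp add: Q subst_form_def bqf_eval_def)
    then show ?thesis unfolding ambiguous_def by force
  next
    case 2
    then have "subst_form Q 1 1 0 (- 1) = Q" by (simp add: Q subst_form_def bqf_eval_def)
    then show ?thesis unfolding ambiguous_def by force
  next
    case 3
    then have "subst_form Q 0 1 1 0 = Q" by (simp add: Q subst_form_def bqf_eval_def)
    then show ?thesis unfolding ambiguous_def by force
  qed
qed

text \<open>
  A class of order at most two has the principal class as its square. Comparing coefficients,
  invariance under an improper automorphism with columns \<open>(p, r)\<close> and \<open>(q, s)\<close> forces
  \<open>s = - p\<close> and \<open>k q = b p + k c r\<close>, so \<open>k\<close> divides \<open>b p\<close> and hence \<open>p\<close>. Then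
  \<open>k F(p / k, r) = f(p, r) = k\<close>, where \<open>f = (k, b, k c)\<close> and \<open>F = (k\<^sup>2, b, c)\<close>.
\<close>

lemma ambiguous_duplication:
  assumes amb: "ambiguous (BQF k b (k * c))" and cop: "coprime k b" and k0: "k \<noteq> 0"
  shows "represents (BQF (k\<^sup>2) b c) 1"
proof -
  obtain p q r s where det: "p * s - q * r = - 1"
    and e1: "k * p\<^sup>2 + b * p * r + k * c * r\<^sup>2 = k"
    and e2: "2 * k * p * q + b * (p * s + q * r) + 2 * (k * c) * r * s = b"
    and e3: "k * q\<^sup>2 + b * q * s + k * c * s\<^sup>2 = k * c"
    using amb by (auto simp: ambiguous_def subst_form_def bqf_eval_def)
  have "2 * k * (s + p) = 0" using det e1 e2 by algebra
  then have s: "s = - p" using k0 by simp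
  have "2 * (k * q) = 2 * (b * p + k * c * r)" using det e1 e2 e3 s by algebra
  then have kq: "k * q = b * p + k * c * r" by simp
  then have "b * p = k * (q - c * r)" by (simp add: algebra_simps)
  then have "k dvd p" using cop by (metis coprime_dvd_mult_right_iff dvd_triv_left)
  then obtain x where x: "p = k * x" by blast
  have "k * bqf_eval (BQF (k\<^sup>2) b c) x r = k * 1"
    using e1 by (simp add: x bqf_eval_def algebra_simps power2_eq_square)
  then show ?thesis using k0 unfolding represents_def by auto
qed

section \<open>The principal form\<close>

lemma principal_form_exists:
  assumes "\<Delta> < 0" "\<Delta> mod 4 = 0 \<or> \<Delta> mod 4 = 1"
  shows "\<exists>P. coeff_a P = 1 \<and> reduced P \<and> discriminant P = \<Delta> \<and> ambiguous P"
proof -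
  define \<beta> where "\<beta> = \<Delta> mod 4"
  define P where "P = BQF 1 \<beta> (- (\<Delta> div 4))"
  have \<beta>: "\<beta> = 0 \<or> \<beta> = 1" using assms(2) by (simp add: \<beta>_def)
  then have "\<beta>\<^sup>2 = \<beta>" by auto
  then have "discriminant P = \<Delta>" by (simp add: P_def discriminant_def \<beta>_def)
  moreover have "- (\<Delta> div 4) \<ge> 1" using assms(1) by presburger
  then have "reduced P" using \<beta> by (auto simp: P_def reduced_def)
  moreover have "ambiguous P" using \<beta> by (intro ambiguous_if_symmetric) (auto simp: P_def)
  ultimately show ?thesis by (intro exI[of _ P]) (simp add: P_def)
qed

text \<open>
  If \<open>Q\<close> is the norm on an ideal, divided by the norm of the ideal, and \<open>P\<close> is the norm on the
  order, this is the multiplicativity of the norm. In coordinates, the second basis vector of the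
  order acts on the ideal by the matrix with rows \<open>(j, - c)\<close> and \<open>(a, b + j)\<close>, where
  \<open>\<beta> = b + 2 j\<close> is its trace and \<open>\<gamma>\<close> its determinant.
\<close>

lemma norm_form_multiplies:
  assumes "discriminant P = discriminant Q" "coeff_a P = 1"
    and "represents P m" "represents Q n"
  shows "represents Q (m * n)"
proof -
  obtain \<beta> \<gamma> where P: "P = BQF 1 \<beta> \<gamma>" using assms(2) by (cases P) simp
  obtain a b c where Q: "Q = BQF a b c" by (cases Q)
  have disc: "\<beta>\<^sup>2 - 4 * \<gamma> = b\<^sup>2 - 4 * (a * c)"
    using assms(1) by (simp add: P Q discriminant_def)
  have "even (\<beta>\<^sup>2 - 4 * \<gamma>) = even (b\<^sup>2 - 4 * (a * c))" by (simp only: disc)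
  then have "even (\<beta> - b)" by simp
  then obtain j where j: "\<beta> = b + 2 * j" by (metis evenE diff_eq_eq add.commute)
  have "4 * \<gamma> = 4 * (j * (b + j) + a * c)"
    using disc by (simp add: j power2_eq_square algebra_simps)
  then have \<gamma>: "\<gamma> = j * (b + j) + a * c" by simp
  obtain z w where m: "bqf_eval P z w = m" using assms(3) unfolding represents_def by blast
  obtain x y where n: "bqf_eval Q x y = n" using assms(4) unfolding represents_def by blast
  have "bqf_eval Q (z * x + w * (j * x - c * y)) (z * y + w * (a * x + (b + j) * y))
      = bqf_eval P z w * bqf_eval Q x y"
    unfolding bqf_eval_def P Q j \<gamma> by (simp add: power2_eq_square algebra_simps)
  then show ?thesis using m n unfolding represents_def by metis
qed

text \<open>
  The minimum of such a form is 1, hence \<open>a = 1\<close> and \<open>b\<close> is 0 or 1. The parity of the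
  discriminant decides which.
\<close>

lemma reduced_represents_one_unique:
  assumes "reduced Q" "coeff_a Q > 0" "represents Q 1"
    and "reduced R" "coeff_a R > 0" "represents R 1"
    and disc: "discriminant Q = discriminant R"
  shows "Q = R"
proof -
  have one: "coeff_a T = 1 \<and> (coeff_b T = 0 \<or> coeff_b T = 1)"
    if T: "reduced T" "coeff_a T > 0" "represents T 1" for T
  proof -
    obtain x y where xy: "bqf_eval T x y = 1" using T(3) unfolding represents_def by blast
    then have "(x, y) \<noteq> (0, 0)" by (auto simp: bqf_eval_def)
    then have "coeff_a T \<le> 1" using reduced_eval_ge(2)[OF T(1,2), of x y] xy by simp
    then have "coeff_a T = 1" using T(2) by simp
    then show ?thesis using T(1) by (auto simp: reduced_def)
  qed
  have "even (discriminant Q) = even (discriminant R)" by (simp only: disc)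
  then have "even (coeff_b Q) = even (coeff_b R)" by (simp add: discriminant_def)
  then have "coeff_b Q = coeff_b R" using one[OF assms(1-3)] one[OF assms(4-6)] by auto
  then show ?thesis
    using form_eqI_discriminant one[OF assms(1-3)] one[OF assms(4-6)] disc by simp
qed

section \<open>Forms of fundamental discriminant\<close>

text \<open>
  Both uses of fundamentality rest on this: taken with \<open>e = a c\<close> it gives primitivity of
  \<open>(a, b, c)\<close>, and with \<open>e = k\<^sup>2 c\<close> it gives that \<open>k\<close> and \<open>b\<close> are coprime. A nontrivial \<open>g\<close>
  would make \<open>g\<^sup>2\<close> a factor of \<open>\<Delta>\<close> whose cofactor is again a discriminant.
\<close>

lemma fundamental_square_divisor:
  assumes fund: "fundamental_discriminant \<Delta>" and disc: "b\<^sup>2 - 4 * e = \<Delta>"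
    and g: "g dvd b" "g\<^sup>2 dvd e"
  shows "is_unit g"
proof -
  obtain h where h: "b = g * h" using g(1) by blast
  obtain f where f: "e = g\<^sup>2 * f" using g(2) by blast
  have D: "\<Delta> = g\<^sup>2 * (h\<^sup>2 - 4 * f)" using disc h f by (simp add: algebra_simps power_mult_distrib)
  show ?thesis
  proof (cases "squarefree \<Delta>")
    case True
    have "g\<^sup>2 dvd \<Delta>" unfolding D by (rule dvd_triv_left)
    then show ?thesis by (rule squarefreeD[OF True])
  next
    case False
    then obtain n where n: "\<Delta> = 4 * n" "n mod 4 = 2 \<or> n mod 4 = 3" "squarefree n"
      using fund unfolding fundamental_discriminant_def by blast
    have "b\<^sup>2 = 2 * (2 * (n + e))" using disc n(1) by simp
    then have "even (b\<^sup>2)" by (metis dvd_triv_left)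
    then obtain \<beta> where \<beta>: "b = 2 * \<beta>" by auto
    have n': "n = \<beta>\<^sup>2 - e" using disc n(1) \<beta> by (simp add: power_mult_distrib)
    show ?thesis
    proof (cases "even g")
      case True
      then have "4 dvd g\<^sup>2" by (auto simp: power_mult_distrib)
      then have "4 dvd e" using g(2) dvd_trans by blast
      then obtain e' where "e = 4 * e'" by blast
      moreover have "\<beta>\<^sup>2 mod 4 = 0 \<or> \<beta>\<^sup>2 mod 4 = 1"
      proof (cases "even \<beta>")
        case True
        then show ?thesis by (auto simp: power_mult_distrib)
      next
        case False
        then obtain j where "\<beta> = 2 * j + 1" by (elim oddE)
        then have "\<beta>\<^sup>2 = 4 * (j\<^sup>2 + j) + 1" by (simp add: power2_eq_square algebra_simps)
        then show ?thesis by presburger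
      qed
      ultimately have False using n(2) n' by presburger
      then show ?thesis ..
    next
      case False
      then have "coprime g 2" by simp
      then have "g dvd \<beta>" using g(1) \<beta> by (simp add: coprime_dvd_mult_right_iff)
      then have "g\<^sup>2 dvd \<beta>\<^sup>2" by simp
      then have "g\<^sup>2 dvd n" using g(2) n' by simp
      then show ?thesis by (rule squarefreeD[OF n(3)])
    qed
  qed
qed

lemma reduced_forms_iff:
  assumes "fundamental_discriminant \<Delta>" "\<Delta> < 0"
  shows "Q \<in> reduced_forms \<Delta> \<longleftrightarrow> coeff_a Q > 0 \<and> reduced Q \<and> discriminant Q = \<Delta>"
proof -
  have "primitive Q" if "discriminant Q = \<Delta>"
  proof -
    define g where "g = Gcd {coeff_a Q, coeff_b Q, coeff_c Q}"
    have g: "g dvd coeff_a Q" "g dvd coeff_b Q" "g dvd coeff_c Q"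
      unfolding g_def by (rule Gcd_dvd, simp)+
    then have "g\<^sup>2 dvd coeff_a Q * coeff_c Q" by (simp add: power2_eq_square mult_dvd_mono)
    then have "is_unit g"
      using fundamental_square_divisor[OF assms(1) _ g(2)] that
      by (simp add: discriminant_def mult.assoc)
    then have "normalize g = 1" by (simp add: is_unit_normalize)
    then show ?thesis unfolding primitive_def g_def by simp
  qed
  then show ?thesis
    using positive_definite_iff assms(2) unfolding reduced_forms_def by auto
qed

text \<open>
  Dividing out the greatest common divisor of the arguments leaves a square \<open>k\<^sup>2\<close> represented by
  coprime arguments, which extend to a basis of \<open>\<int>\<^sup>2\<close> of determinant 1.
\<close>

lemma square_leading_coefficient:
  assumes fund: "fundamental_discriminant (discriminant Q)"
    and rep: "represents Q (m\<^sup>2)" and m0: "m \<noteq> 0"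
  shows "\<exists>k b c. k > 0 \<and> coprime k b \<and> properly_equivalent Q (BQF (k\<^sup>2) b c)"
proof -
  obtain x y where xy: "bqf_eval Q x y = m\<^sup>2" using rep unfolding represents_def by blast
  have "(x, y) \<noteq> (0, 0)" using xy m0 by (auto simp: bqf_eval_def)
  define g where "g = gcd x y"
  have g0: "g \<noteq> 0" using \<open>(x, y) \<noteq> (0, 0)\<close> by (auto simp: g_def)
  obtain p r where pr: "x = g * p" "y = g * r" "coprime p r"
    using gcd_coprime_exists[of x y] g0 unfolding g_def by (metis mult.commute)
  have sq: "g\<^sup>2 * bqf_eval Q p r = m\<^sup>2"
    using xy by (simp add: pr bqf_eval_def power2_eq_square algebra_simps)
  then have "g\<^sup>2 dvd m\<^sup>2" by (metis dvd_triv_left)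
  then have "g dvd m" by simp
  then obtain k0 where k0: "m = g * k0" by blast
  define k where "k = \<bar>k0\<bar>"
  have k: "k > 0" using k0 m0 by (auto simp: k_def)
  have ev: "bqf_eval Q p r = k\<^sup>2" using sq g0 by (simp add: k0 k_def power_mult_distrib)
  obtain u v where uv: "u * p + v * r = 1" using pr(3) bezout_int[of p r] by auto
  define R where "R = subst_form Q p (- v) r u"
  have QR: "properly_equivalent Q R"
    unfolding R_def by (rule properly_equivalentI) (use uv in \<open>simp add: algebra_simps\<close>)
  obtain b c where R: "R = BQF (k\<^sup>2) b c"
    by (cases R) (use ev in \<open>simp add: R_def subst_form_def\<close>)
  have disc: "b\<^sup>2 - 4 * (k\<^sup>2 * c) = discriminant Q"
    using properly_equivalent_discriminant[OF QR] by (simp add: R discriminant_def)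
  have "(gcd k b)\<^sup>2 dvd k\<^sup>2 * c" by (simp add: dvd_mult2)
  then have "is_unit (gcd k b)"
    by (rule fundamental_square_divisor[OF fund disc gcd_dvd2])
  then have "coprime k b" by (simp add: coprime_iff_gcd_eq_1)
  then show ?thesis using k QR R by blast
qed

section \<open>Parity of the class number\<close>

text \<open>
  The opposite \<open>(a, - b, c)\<close> of a reduced form is reduced unless \<open>b = a\<close> or \<open>a = c > b > 0\<close>,
  and differs from it unless \<open>b = 0\<close>. So the forms outside the displayed set come in pairs.
\<close>

lemma card_reduced_forms_parity:
  assumes "fundamental_discriminant \<Delta>" "\<Delta> < 0"
  shows "even (card (reduced_forms \<Delta>)) \<longleftrightarrow> even (card {Q \<in> reduced_forms \<Delta>.
    coeff_b Q = 0 \<or> coeff_b Q = coeff_a Q \<or> coeff_a Q = coeff_c Q})"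
proof -
  let ?S = "reduced_forms \<Delta>"
  let ?amb = "\<lambda>Q. coeff_b Q = 0 \<or> coeff_b Q = coeff_a Q \<or> coeff_a Q = coeff_c Q"
  define A where "A = {Q \<in> ?S. ?amb Q}"
  define B where "B = {Q \<in> ?S. \<not> ?amb Q \<and> coeff_b Q > 0}"
  define C where "C = {Q \<in> ?S. \<not> ?amb Q \<and> coeff_b Q < 0}"
  define opp where "opp Q = BQF (coeff_a Q) (- coeff_b Q) (coeff_c Q)" for Q
  note mem = reduced_forms_iff[OF assms]
  have fin: "finite A" "finite B" "finite C"
    using finite_reduced_forms by (simp_all add: A_def B_def C_def)
  have "bij_betw opp B C"
  proof (rule bij_betwI[where g = opp])
    show "opp \<in> B \<rightarrow> C"
      by (auto simp: B_def C_def opp_def mem reduced_def discriminant_def)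
    show "opp \<in> C \<rightarrow> B"
      by (auto simp: B_def C_def opp_def mem reduced_def discriminant_def)
  qed (simp_all add: opp_def)
  then have "card B = card C" by (rule bij_betw_same_card)
  moreover have "?S = A \<union> (B \<union> C)" by (auto simp: A_def B_def C_def)
  moreover have "A \<inter> (B \<union> C) = {}" "B \<inter> C = {}" by (auto simp: A_def B_def C_def)
  ultimately have "card ?S = card A + 2 * card B"
    using fin by (simp add: card_Un_disjoint)
  then show ?thesis by (simp add: A_def)
qed

text \<open>
  The hypothesis says that every class lies in the principal genus; the proof extracts a square
  root from every class. Injectivity of \<open>root\<close> on a finite set makes every form a root,
  and an ambiguous root can only be the root of the principal form.
\<close>

lemma odd_class_number_if_squares:
  assumes \<Delta>: "\<Delta> < 0" "\<Delta> mod 4 = 0 \<or> \<Delta> mod 4 = 1" "fundamental_discriminant \<Delta>"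
    and squares: "\<And>Q. Q \<in> reduced_forms \<Delta> \<Longrightarrow> \<exists>m. m \<noteq> 0 \<and> represents Q (m\<^sup>2)"
  shows "odd (class_number \<Delta>)"
proof -
  let ?S = "reduced_forms \<Delta>"
  note mem = reduced_forms_iff[OF \<Delta>(3,1)]
  have "\<exists>R k b c. R \<in> ?S \<and> k > 0 \<and> coprime k b \<and> properly_equivalent Q (BQF (k\<^sup>2) b c)
      \<and> properly_equivalent (BQF k b (k * c)) R" if Q: "Q \<in> ?S" for Q
  proof -
    have disc: "discriminant Q = \<Delta>" using Q by (simp add: mem)
    obtain m where "m \<noteq> 0" "represents Q (m\<^sup>2)" using squares[OF Q] by blast
    then obtain k b c
      where k: "k > 0" "coprime k b" "properly_equivalent Q (BQF (k\<^sup>2) b c)"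
      using square_leading_coefficient[of Q m] \<Delta>(3) disc by auto
    let ?f = "BQF k b (k * c)"
    have f: "coeff_a ?f > 0" "discriminant ?f = \<Delta>"
      using k(1) properly_equivalent_discriminant[OF k(3)] disc
      by (simp_all add: discriminant_def power2_eq_square algebra_simps)
    then obtain R where R: "properly_equivalent ?f R" "reduced R"
      using exists_reduced[of ?f] \<Delta>(1) by auto
    have "coeff_a R > 0" using properly_equivalent_a_pos[OF f(1) _ R(1)] f(2) \<Delta>(1) by simp
    then have "R \<in> ?S"
      using R properly_equivalent_discriminant[OF R(1)] f(2) by (simp add: mem)
    then show ?thesis using k R by blast
  qed
  then obtain root k b c where root: "\<And>Q. Q \<in> ?S \<Longrightarrow> root Q \<in> ?S"
    and k: "\<And>Q. Q \<in> ?S \<Longrightarrow> k Q > 0" "\<And>Q. Q \<in> ?S \<Longrightarrow> coprime (k Q) (b Q)"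
    and Q_eq: "\<And>Q. Q \<in> ?S \<Longrightarrow> properly_equivalent Q (BQF ((k Q)\<^sup>2) (b Q) (c Q))"
    and root_eq: "\<And>Q. Q \<in> ?S \<Longrightarrow> properly_equivalent (BQF (k Q) (b Q) (k Q * c Q)) (root Q)"
    by metis
  have "inj_on root ?S"
  proof (rule inj_onI)
    fix Q R assume Q: "Q \<in> ?S" and R: "R \<in> ?S" and eq: "root Q = root R"
    have "properly_equivalent (BQF (k Q) (b Q) (k Q * c Q)) (BQF (k R) (b R) (k R * c R))"
      using root_eq[OF Q] root_eq[OF R] eq properly_equivalent_sym properly_equivalent_trans
      by metis
    then have "properly_equivalent (BQF ((k Q)\<^sup>2) (b Q) (c Q)) (BQF ((k R)\<^sup>2) (b R) (c R))"
      using duplication_well_defined k(1)[OF R] k(2)[OF R] by simp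
    then have "properly_equivalent Q R"
      using Q_eq[OF Q] Q_eq[OF R] properly_equivalent_sym properly_equivalent_trans by metis
    then show "Q = R" using reduced_unique[of Q R] Q R by (simp add: mem)
  qed
  then have surj: "root ` ?S = ?S"
    using root finite_reduced_forms by (intro endo_inj_surj) auto
  obtain P where P: "coeff_a P = 1" "reduced P" "discriminant P = \<Delta>" "ambiguous P"
    using principal_form_exists[OF \<Delta>(1,2)] by blast
  have PS: "P \<in> ?S" using P by (simp add: mem)
  have "bqf_eval P 1 0 = 1" using P by (simp add: bqf_eval_def)
  then have P1: "represents P 1" unfolding represents_def by blast
  have amb: "A = root P" if A: "A \<in> ?S" "ambiguous A" for A
  proof -
    obtain Q where Q: "Q \<in> ?S" "A = root Q" using surj A(1) by blast
    have "ambiguous (BQF (k Q) (b Q) (k Q * c Q))"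
      using ambiguous_equivalent A(2) Q(2) properly_equivalent_sym[OF root_eq[OF Q(1)]] by simp
    then have "represents (BQF ((k Q)\<^sup>2) (b Q) (c Q)) 1"
      using ambiguous_duplication k(1,2)[OF Q(1)] by simp
    then have "represents Q 1"
      using properly_equivalent_represents[OF Q_eq[OF Q(1)]] by blast
    then have "Q = P" using reduced_represents_one_unique Q(1) PS P1 mem by simp
    then show ?thesis using Q(2) by simp
  qed
  have "{Q \<in> ?S. coeff_b Q = 0 \<or> coeff_b Q = coeff_a Q \<or> coeff_a Q = coeff_c Q} = {P}"
  proof (intro equalityI subsetI)
    fix A
    assume "A \<in> {Q \<in> ?S. coeff_b Q = 0 \<or> coeff_b Q = coeff_a Q \<or> coeff_a Q = coeff_c Q}"
    then have "A = root P" using amb ambiguous_if_symmetric by blast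
    then show "A \<in> {P}" using amb[OF PS P(4)] by simp
  next
    fix A assume "A \<in> {P}"
    moreover have "coeff_b P = 0 \<or> coeff_b P = coeff_a P"
      using P(1,2) by (auto simp: reduced_def)
    ultimately show "A \<in> {Q \<in> ?S. coeff_b Q = 0 \<or> coeff_b Q = coeff_a Q \<or> coeff_a Q = coeff_c Q}"
      using PS by blast
  qed
  then show ?thesis
    using card_reduced_forms_parity[OF \<Delta>(3,1)] by (simp add: class_number_def)
qed

theorem theorem2:
  fixes \<Delta> :: int
  assumes "\<Delta> < 0"
    and "\<Delta> mod 4 = 0 \<or> \<Delta> mod 4 = 1"
    and "fundamental_discriminant \<Delta>"
    and "even (class_number \<Delta>)"
  shows "\<forall>m. (\<forall>Q \<in> reduced_forms \<Delta>. represents Q m) \<longleftrightarrow> m = 0"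
proof (intro allI iffI)
  fix m :: int
  assume "m = 0"
  then show "\<forall>Q \<in> reduced_forms \<Delta>. represents Q m"
    unfolding represents_def by (auto simp: bqf_eval_def intro!: exI[of _ 0])
next
  fix m assume all: "\<forall>Q \<in> reduced_forms \<Delta>. represents Q m"
  obtain P where P: "coeff_a P = 1" "reduced P" "discriminant P = \<Delta>"
    using principal_form_exists[OF assms(1,2)] by blast
  have PS: "P \<in> reduced_forms \<Delta>" using P by (simp add: reduced_forms_iff[OF assms(3,1)])
  show "m = 0"
  proof (rule ccontr)
    assume "m \<noteq> 0"
    have "represents Q (m\<^sup>2)" if Q: "Q \<in> reduced_forms \<Delta>" for Q
      using norm_form_multiplies[of P Q m m] P Q PS all
      by (simp add: reduced_forms_iff[OF assms(3,1)] power2_eq_square)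
    then have "odd (class_number \<Delta>)"
      using \<open>m \<noteq> 0\<close> by (intro odd_class_number_if_squares[OF assms(1-3)]) blast
    then show False using assms(4) by simp
  qed
qed

end
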